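(* Let $N\geq 2$, $f\in C^1(\mathbb{R})$, and let $u$ be a nonconstant radial stable solution of $-\Delta u=f(u)$ in $\mathbb{R}^N\setminus B_1$ satisfying the following property: $(H_L)$ There exists $R_1\geq 1$ such that $$\int_{R_1}^{R_2} r^{N-1}u_r^2\left(\eta'^2-\frac{N-1}{r^2}\eta^2\right)dr\geq 0$$ for every $R_2>R_1$ and every $\eta\in C^{0,1}([R_1,R_2])$ such that $\eta(R_2)=0$. Then the limit $u_\infty:=\lim_{r\to\infty}u(r)\in[-\infty,+\infty]$ exists and there exist $M>0$ and $r_0\geq 1$ such that - $|u(r)|\geq M r^{-N/2+\sqrt{N-1}+2}$ for all $r\geq r_0$, if $2\leq N\leq 9$; - $|u(r)|\geq M\log(r)$ for all $r\geq r_0$, if $N=10$; - $|u(r)-u_\infty|\geq M r^{-N/2+\sqrt{N-1}+2}$ for all $r\geq r_0$, if $N\geq 11$.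
   Context: $B_1$ is the open unit ball of $\mathbb{R}^N$, so $\mathbb{R}^N\setminus B_1=\{x:|x|\geq 1\}$. Solutions are classical: $u\in C^2(\mathbb{R}^N\setminus B_1)$ (up to the boundary). A solution $u$ of $-\Delta u=f(u)$ in $\mathbb{R}^N\setminus B_1$ is called stable if $\int_{\mathbb{R}^N\setminus\overline{B_1}}\left(|\nabla v|^2-f'(u)v^2\right)dx\geq 0$ for every $v\in C^1(\mathbb{R}^N\setminus\overline{B_1})$ with compact support in $\mathbb{R}^N\setminus\overline{B_1}$. For radial $u$ one writes $u(r)$ for $u(x)$ with $r=|x|$, and $u_r$ is the radial derivative. $C^{0,1}$ denotes Lipschitz functions. When $u_\infty=\pm\infty$, one has $|u(r)-u_\infty|=+\infty$, so the last inequality is vacuous. *)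

theory Defs
  imports "HOL-Analysis.Analysis"
begin

text \<open>
  Derivatives relative to a set \<open>S\<close>. All sets used are either open or the closed exterior of a
  ball, whose tangent cones span the whole space; hence the Frechet derivative within \<open>S\<close> is
  unique at every point of \<open>S\<close>, and being $C^k$ on a closed \<open>S\<close> means $C^k$ up to the boundary.
\<close>

definition partial_deriv_on ::
  "'a::euclidean_space set \<Rightarrow> 'a \<Rightarrow> ('a \<Rightarrow> real) \<Rightarrow> 'a \<Rightarrow> real" where
  "partial_deriv_on S b u x = frechet_derivative u (at x within S) b"

definition gradient_on ::
  "'a::euclidean_space set \<Rightarrow> ('a \<Rightarrow> real) \<Rightarrow> 'a \<Rightarrow> 'a" where
  "gradient_on S u x = (\<Sum>b\<in>Basis. partial_deriv_on S b u x *\<^sub>R b)"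

definition laplacian_on ::
  "'a::euclidean_space set \<Rightarrow> ('a \<Rightarrow> real) \<Rightarrow> 'a \<Rightarrow> real" where
  "laplacian_on S u x = (\<Sum>b\<in>Basis. partial_deriv_on S b (partial_deriv_on S b u) x)"

definition C1_on :: "'a::euclidean_space set \<Rightarrow> ('a \<Rightarrow> real) \<Rightarrow> bool" where
  "C1_on S u \<longleftrightarrow>
     u differentiable_on S \<and> (\<forall>b\<in>Basis. continuous_on S (partial_deriv_on S b u))"

definition C2_on :: "'a::euclidean_space set \<Rightarrow> ('a \<Rightarrow> real) \<Rightarrow> bool" where
  "C2_on S u \<longleftrightarrow> C1_on S u \<and> (\<forall>b\<in>Basis. C1_on S (partial_deriv_on S b u))"

definition classical_solution ::
  "'a::euclidean_space set \<Rightarrow> (real \<Rightarrow> real) \<Rightarrow> ('a \<Rightarrow> real) \<Rightarrow> bool" where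
  "classical_solution S f u \<longleftrightarrow> C2_on S u \<and> (\<forall>x\<in>S. - laplacian_on S u x = f (u x))"

definition compactly_supported_in ::
  "'a::euclidean_space set \<Rightarrow> ('a \<Rightarrow> real) \<Rightarrow> bool" where
  "compactly_supported_in \<Omega> v \<longleftrightarrow>
     compact (closure {x \<in> \<Omega>. v x \<noteq> 0}) \<and> closure {x \<in> \<Omega>. v x \<noteq> 0} \<subseteq> \<Omega>"

text \<open>For \<open>f\<close> of class $C^1$ and \<open>u\<close> continuous on the open set \<open>\<Omega>\<close>, the integrand below is
  continuous on \<open>\<Omega>\<close> with compact support, so the integral is never a default value.\<close>

definition stable_on ::
  "'a::euclidean_space set \<Rightarrow> (real \<Rightarrow> real) \<Rightarrow> ('a \<Rightarrow> real) \<Rightarrow> bool" where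
  "stable_on \<Omega> f u \<longleftrightarrow>
     (\<forall>v. C1_on \<Omega> v \<and> compactly_supported_in \<Omega> v \<longrightarrow>
        (LINT x:\<Omega>|lebesgue. (norm (gradient_on \<Omega> v x))\<^sup>2 - deriv f (u x) * (v x)\<^sup>2) \<ge> 0)"

text \<open>
  Property $(H_L)$ in dimension \<open>N\<close> for a radial profile \<open>U\<close>. A Lipschitz \<open>\<eta>\<close> is differentiable
  almost everywhere on $(R_1,R_2)$, so the values of \<open>deriv \<eta>\<close> elsewhere, like that of \<open>deriv U\<close>
  at \<open>1\<close>, do not affect the integral.
\<close>

definition H_L :: "nat \<Rightarrow> (real \<Rightarrow> real) \<Rightarrow> bool" where
  "H_L N U \<longleftrightarrow>
     (\<exists>R1\<ge>1. \<forall>R2>R1. \<forall>\<eta>. (\<exists>C. C-lipschitz_on {R1..R2} \<eta>) \<and> \<eta> R2 = 0 \<longrightarrow>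
        (LINT r:{R1..R2}|lebesgue.
           r ^ (N - 1) * (deriv U r)\<^sup>2 * ((deriv \<eta> r)\<^sup>2 - (real N - 1) / r\<^sup>2 * (\<eta> r)\<^sup>2)) \<ge> 0)"

end

theory Submission imports Defs begin

text \<open>
  Write $w = u_r$ and $a = \sqrt{N-1}$. If $w$ vanished at some $R_2 > R_1$, then cutting off the
  constant $1$ near $R_2$ in $(H_L)$ would force $w = 0$ on $[R_1, R_2]$, and $u$ would be constant by
  uniqueness for the radial equation. So $u$ is strictly monotone beyond $R_1$. Now take $\eta$
  constant up to a fixed $p$, equal to $r^{-a}$ on $[p, R]$, and decreasing to $0$ on $[R, 2R]$ with
  $\eta'$ proportional to $|w|^{-1/2}$. The middle piece contributes $0$ and the first one a fixed
  negative number, so the last one is bounded below. By convexity of $t^{-1/2}$ this gives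
  $|u(2R) - u(R)| \geq C R^{-N/2+a+2}$, and monotonicity does the rest.
\<close>

subsection \<open>The radial equation\<close>

text \<open>The exponent a is the one for which \<eta> = r^(-a) satisfies \<eta>'^2 = (N-1) \<eta>^2
  / r^2 exactly. The middle piece is therefore free however far out R lies, and the deficit of the
  constant piece, fixed together with p, must be paid by the tail alone.

  The tail pays r^(N-1) w^2 \<eta>'^2. Taking \<eta>' proportional to |w|^(-1/2) turns w^2 \<eta>'^2
  into a multiple of |w|, whose integral D over [R, 2R] is |u(2R) - u(R)|. The factor of
  proportionality is R^(-a) divided by the integral of |w|^(-1/2), and by convexity that integral is
  at least R^(3/2) D^(-1/2). So a fixed positive constant is at most a multiple of R^(N-1) R^(-2a) D
  (D / R^3), and solving for D gives the exponent (4-N)/2 + a. The choice of \<eta>' makes sense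
  only where w has no zero, which is why nonvanishing has to come before the estimate.\<close>

lemma has_derivative_exterior_ball:
  fixes v :: "'a::euclidean_space \<Rightarrow> real"
  assumes "v differentiable_on - ball 0 1" "norm x > 1"
  shows "(v has_derivative frechet_derivative v (at x within - ball 0 1)) (at x)"
proof -
  have "x \<in> interior (- ball 0 1)"
  proof (rule interiorI)
    show "open (- cball (0::'a) 1)" by (simp add: open_Compl)
  qed (use assms(2) in auto)
  then have "at x within - ball 0 1 = at x" by (rule at_within_interior)
  moreover have "v differentiable (at x within - ball 0 1)"
    using assms by (auto simp: differentiable_on_def)
  ultimately show ?thesis by (metis frechet_derivative_works)
qed

text \<open>Only the values of \<open>U\<close> on [1, \<infinity>) are tied to \<open>u\<close>,
  and no smoothness of \<open>U\<close> is given, so \<open>w\<close> and \<open>w'\<close> are read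
  off as iterated partial derivatives of \<open>u\<close> along the ray through one basis vector
  \<open>e\<close>. In the Laplacian at \<open>r *\<^sub>R e\<close> the radial direction yields
  \<open>w' r\<close> and each of the remaining directions \<open>w r / r\<close>. Two-sided
  derivatives are claimed for r > 1 only, since \<open>U\<close> is arbitrary below 1.\<close>

lemma radial_reduction:
  fixes u :: "'a::euclidean_space \<Rightarrow> real"
  assumes C2: "C2_on (- ball 0 1) u" and rad: "\<forall>x \<in> - ball 0 1. u x = U (norm x)"
  obtains w w' where "continuous_on {1..} U" "continuous_on {1..} w"
    "\<And>r. r > 1 \<Longrightarrow> (U has_real_derivative w r) (at r)"
    "\<And>r. r > 1 \<Longrightarrow> (w has_real_derivative w' r) (at r)"
    "\<And>r. r > 1 \<Longrightarrow> \<exists>x. norm x = r \<and>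
      laplacian_on (- ball 0 1) u x = w' r + (real DIM('a) - 1) / r * w r"
proof -
  let ?S = "- ball (0::'a) 1"
  define P where "P b = partial_deriv_on ?S b u" for b
  have du: "u differentiable_on ?S" and cP: "\<And>b. b \<in> Basis \<Longrightarrow> continuous_on ?S (P b)"
    and dP: "\<And>b. b \<in> Basis \<Longrightarrow> P b differentiable_on ?S"
    using C2 by (auto simp: C2_on_def C1_on_def P_def)
  obtain e :: 'a where e: "e \<in> Basis" using nonempty_Basis by blast
  then have ne: "norm e = 1" by simp
  have line: "((\<lambda>s. v (s *\<^sub>R e)) has_real_derivative partial_deriv_on ?S e v (r *\<^sub>R e)) (at r)"
    if "v differentiable_on ?S" "r > 1" for v r
  proof -
    have "(v has_derivative frechet_derivative v (at (r *\<^sub>R e) within ?S)) (at (r *\<^sub>R e))"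
      (is "(_ has_derivative ?D) _")
      using that ne by (intro has_derivative_exterior_ball) auto
    then have "((\<lambda>s. v (s *\<^sub>R e)) has_derivative (\<lambda>s. ?D (s *\<^sub>R e))) (at r)"
      by (rule has_derivative_compose[rotated]) (auto intro!: derivative_eq_intros)
    moreover have "linear ?D"
      using \<open>(v has_derivative ?D) _\<close> has_derivative_linear by blast
    then have "(\<lambda>s. ?D (s *\<^sub>R e)) = (\<lambda>s. partial_deriv_on ?S e v (r *\<^sub>R e) * s)"
      by (auto simp: partial_deriv_on_def linear_cmul)
    ultimately show ?thesis by (simp add: has_field_derivative_def)
  qed
  define w where "w r = P e (r *\<^sub>R e)" for r
  define w' where "w' r = partial_deriv_on ?S e (P e) (r *\<^sub>R e)" for r
  have ray: "(\<lambda>s::real. s *\<^sub>R e) ` {1..} \<subseteq> ?S" using ne by auto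
  have cu: "continuous_on {1..} (\<lambda>s. u (s *\<^sub>R e))"
    by (rule continuous_on_compose2[OF differentiable_imp_continuous_on[OF du] _ ray])
      (intro continuous_intros)
  have Uu: "u (s *\<^sub>R e) = U s" if "s \<ge> 1" for s using rad that ne by auto
  have cU: "continuous_on {1..} U"
    using cu by (rule continuous_on_eq) (simp add: Uu)
  have cw: "continuous_on {1..} w" unfolding w_def
    by (rule continuous_on_compose2[OF cP[OF e] _ ray]) (intro continuous_intros)
  have dU: "(U has_real_derivative w r) (at r)" if r: "r > 1" for r
    by (rule has_field_derivative_transform_within_open[
          OF line[OF du r, folded P_def w_def] open_greaterThan])
      (use r Uu in auto)
  have dw: "(w has_real_derivative w' r) (at r)" if r: "r > 1" for r
    using line[OF dP[OF e] r] by (simp add: w_def[abs_def] w'_def)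
  \<comment> \<open>The tangential second derivatives need the gradient off the ray. Near x the
    function \<open>u\<close> is \<open>U\<close> composed with the norm, and uniqueness of the
    derivative makes the gradient radial with slope \<open>w (norm x)\<close>.\<close>
  have Pb: "P b x = w (norm x) * inner b (sgn x)" if "norm x > 1" for b x
  proof -
    have 1: "(u has_derivative frechet_derivative u (at x within ?S)) (at x)"
      using du that by (rule has_derivative_exterior_ball)
    have "x \<noteq> 0" using that by auto
    have "(U has_derivative (\<lambda>h. w (norm x) * h)) (at (norm x))"
      using dU[OF that] by (simp add: has_field_derivative_def)
    then have "((\<lambda>x. U (norm x)) has_derivative (\<lambda>h. w (norm x) * inner h (sgn x))) (at x)"
      by (rule has_derivative_compose[OF has_derivative_norm[OF \<open>x \<noteq> 0\<close>]])
    then have "(u has_derivative (\<lambda>h. w (norm x) * inner h (sgn x))) (at x)"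
      by (rule has_derivative_transform_within_open[of _ _ _ _ "- cball 0 1"])
        (use that rad in \<open>auto simp: open_Compl\<close>)
    from has_derivative_unique[OF 1 this] show ?thesis
      by (simp add: P_def partial_deriv_on_def)
  qed
  have lap: "laplacian_on ?S u (r *\<^sub>R e) = w' r + (real DIM('a) - 1) / r * w r" if r: "r > 1" for r
  proof -
    \<comment> \<open>A move orthogonal to \<open>e\<close> leaves the norm unchanged to first
      order, so in the product \<open>w (?n t) * (t / ?n t)\<close> only the factor \<open>t\<close>
      contributes to the derivative at 0.\<close>
    have off: "partial_deriv_on ?S b (P b) (r *\<^sub>R e) = w r / r" if b: "b \<in> Basis - {e}" for b
    proof -
      let ?D = "frechet_derivative (P b) (at (r *\<^sub>R e) within ?S)"
      let ?n = "\<lambda>t. norm (r *\<^sub>R e + t *\<^sub>R b)"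
      have orth: "inner e b = 0" "inner b e = 0" "inner b b = 1" using b e by (auto simp: inner_Basis)
      have "(P b has_derivative ?D) (at (r *\<^sub>R e))"
        using dP b r ne by (intro has_derivative_exterior_ball) auto
      then have D: "(P b has_derivative ?D) (at (r *\<^sub>R e + 0 *\<^sub>R b))" by simp
      have "((\<lambda>t. P b (r *\<^sub>R e + t *\<^sub>R b)) has_derivative (\<lambda>t. ?D (t *\<^sub>R b))) (at 0)"
        by (rule has_derivative_compose[where f = "\<lambda>t. r *\<^sub>R e + t *\<^sub>R b" and x = 0, OF _ D])
          (auto intro!: derivative_eq_intros)
      moreover have "linear ?D" using D has_derivative_linear by blast
      then have "(\<lambda>t. ?D (t *\<^sub>R b)) = (\<lambda>t. ?D b * t)" by (auto simp: linear_cmul)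
      ultimately have 1: "((\<lambda>t. P b (r *\<^sub>R e + t *\<^sub>R b)) has_real_derivative ?D b) (at 0)"
        by (simp add: has_field_derivative_def)
      have "((\<lambda>t. norm (r *\<^sub>R e + t *\<^sub>R b)) has_derivative
          (\<lambda>t. inner (t *\<^sub>R b) (sgn (r *\<^sub>R e + 0 *\<^sub>R b)))) (at 0)"
        by (rule has_derivative_compose[OF _ has_derivative_norm])
          (use r e in \<open>auto intro!: derivative_eq_intros\<close>)
      moreover have "(\<lambda>t. inner (t *\<^sub>R b) (sgn (r *\<^sub>R e + 0 *\<^sub>R b))) = (\<lambda>t. 0 * t)"
        using orth by (auto simp: sgn_div_norm)
      ultimately have n: "(?n has_real_derivative 0) (at 0)"
        by (simp only: has_field_derivative_def)
      have n0: "?n 0 = r" using r ne by simp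
      have "((\<lambda>t. w (?n t)) has_real_derivative (w' r * 0)) (at 0)"
        using DERIV_chain2[OF _ n, of w "w' r"] dw[OF r] n0 by simp
      then have d: "((\<lambda>t. w (?n t) * (t / ?n t)) has_real_derivative w r / r) (at 0)"
        by (auto intro!: derivative_eq_intros n simp: n0) (use r ne in \<open>auto simp: field_simps\<close>)
      have ev: "\<forall>\<^sub>F t in nhds 0. w (?n t) * (t / ?n t) = P b (r *\<^sub>R e + t *\<^sub>R b)"
      proof -
        have "(?n \<longlongrightarrow> ?n 0) (nhds 0)" by (intro tendsto_intros filterlim_ident)
        then have "\<forall>\<^sub>F t in nhds 0. ?n t > 1" using r n0 by (auto dest: order_tendstoD)
        then show ?thesis
          by eventually_elim (simp add: Pb sgn_div_norm orth inner_right_distrib field_simps)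
      qed
      have "((\<lambda>t. P b (r *\<^sub>R e + t *\<^sub>R b)) has_real_derivative w r / r) (at 0)"
        by (rule iffD1[OF DERIV_cong_ev[OF refl ev refl] d])
      with 1 have "?D b = w r / r" by (rule DERIV_unique)
      then show ?thesis by (simp add: partial_deriv_on_def)
    qed
    have "laplacian_on ?S u (r *\<^sub>R e) = (\<Sum>b\<in>Basis. partial_deriv_on ?S b (P b) (r *\<^sub>R e))"
      by (simp add: laplacian_on_def P_def)
    also have "\<dots> = w' r + (\<Sum>b\<in>Basis - {e}. w r / r)"
      using e off by (simp add: sum.remove[of Basis e] w'_def)
    also have "(\<Sum>b\<in>Basis - {e}. w r / r) = (real DIM('a) - 1) / r * w r"
      using e DIM_positive[where 'a='a] by (simp add: card_Diff_singleton of_nat_diff)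
    finally show ?thesis .
  qed
  show thesis
  proof (rule that[OF cU cw dU dw])
    fix r :: real assume "r > 1"
    then show "\<exists>x. norm x = r \<and> laplacian_on ?S u x = w' r + (real DIM('a) - 1) / r * w r"
      using lap ne by (intro exI[of _ "r *\<^sub>R e"]) auto
  qed
qed

subsection \<open>Admissible piecewise test functions\<close>

text \<open>Nothing is known about \<open>deriv\<close> of a glued function at a break point, nor
  about \<open>deriv U\<close> at 1; as two points form a null set, a continuous replacement
  integrand suffices. Absolute integrability is what lets the Lebesgue integral in
  \<open>H_L\<close> be computed as a gauge integral.\<close>

lemma integral_eq_off_endpoints:
  fixes F G :: "real \<Rightarrow> real"
  assumes "continuous_on {a..b} G" "\<And>r. a < r \<Longrightarrow> r < b \<Longrightarrow> F r = G r"
  shows "F absolutely_integrable_on {a..b}" "integral {a..b} F = integral {a..b} G"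
proof -
  have eq: "F r = G r" if "r \<in> {a..b} - {a, b}" for r using assms(2) that by auto
  show "F absolutely_integrable_on {a..b}"
    by (rule absolutely_integrable_spike[where S = "{a, b}",
          OF absolutely_integrable_continuous_real[OF assms(1)] _ eq]) auto
  show "integral {a..b} F = integral {a..b} G"
    by (rule integral_spike[of "{a, b}"]) (use eq in auto)
qed

lemma C1_imp_lipschitz_on_interval:
  fixes g :: "real \<Rightarrow> real"
  assumes der: "\<And>r. r \<in> {a..b} \<Longrightarrow> (g has_real_derivative g' r) (at r within {a..b})"
    and cont: "continuous_on {a..b} g'"
  obtains L where "L-lipschitz_on {a..b} g"
proof -
  obtain B where B: "\<And>r. r \<in> {a..b} \<Longrightarrow> norm (g' r) \<le> B"
    using compact_imp_bounded[OF compact_continuous_image[OF cont compact_Icc]]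
    unfolding bounded_iff by blast
  have "(max B 0)-lipschitz_on {a..b} g"
  proof (rule bounded_derivative_imp_lipschitz)
    fix r assume r: "r \<in> {a..b}"
    show "(g has_derivative (*) (g' r)) (at r within {a..b})"
      using der[OF r] by (simp add: has_field_derivative_def)
    show "onorm ((*) (g' r)) \<le> max B 0"
      by (rule onorm_le) (use B[OF r] in \<open>auto simp: abs_mult intro!: mult_right_mono\<close>)
  qed auto
  then show thesis by (rule that)
qed

text \<open>The test function is \<open>c\<close> on [R1, p], \<open>g\<close> on [p, q] and
  \<open>h\<close> on [q, R2]; matching values make it Lipschitz, and the integral splits into three
  with continuous integrands free of \<open>deriv\<close>. The case p = q is allowed, so the same
  statement also serves a test function with two pieces.\<close>

lemma H_L_glued:
  fixes w g g' h h' :: "real \<Rightarrow> real"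
  assumes HL: "\<And>\<eta>. (\<exists>C. C-lipschitz_on {R1..R2} \<eta>) \<Longrightarrow> \<eta> R2 = 0 \<Longrightarrow>
        (LINT r:{R1..R2}|lebesgue.
           r ^ (N - 1) * (deriv U r)\<^sup>2 * ((deriv \<eta> r)\<^sup>2 - (real N - 1) / r\<^sup>2 * (\<eta> r)\<^sup>2)) \<ge> 0"
    and ord: "1 \<le> R1" "R1 \<le> p" "p \<le> q" "q < R2"
    and cw: "continuous_on {R1..R2} w" and dU: "\<And>r. r > 1 \<Longrightarrow> deriv U r = w r"
    and dg: "\<And>r. r \<in> {p..q} \<Longrightarrow> (g has_real_derivative g' r) (at r within {p..q})"
    and cg': "continuous_on {p..q} g'"
    and dh: "\<And>r. r \<in> {q..R2} \<Longrightarrow> (h has_real_derivative h' r) (at r within {q..R2})"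
    and ch': "continuous_on {q..R2} h'"
    and match: "g p = c" "g q = h q" "h R2 = 0"
  shows "0 \<le> integral {R1..p} (\<lambda>r. r ^ (N - 1) * (w r)\<^sup>2 * (0\<^sup>2 - (real N - 1) / r\<^sup>2 * c\<^sup>2))
    + integral {p..q} (\<lambda>r. r ^ (N - 1) * (w r)\<^sup>2 * ((g' r)\<^sup>2 - (real N - 1) / r\<^sup>2 * (g r)\<^sup>2))
    + integral {q..R2} (\<lambda>r. r ^ (N - 1) * (w r)\<^sup>2 * ((h' r)\<^sup>2 - (real N - 1) / r\<^sup>2 * (h r)\<^sup>2))"
proof -
  define \<eta> where "\<eta> r = (if r \<le> q then (if r \<le> p then c else g r) else h r)" for r
  define F where "F r = r ^ (N - 1) * (deriv U r)\<^sup>2 *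
    ((deriv \<eta> r)\<^sup>2 - (real N - 1) / r\<^sup>2 * (\<eta> r)\<^sup>2)" for r
  obtain Lg where Lg: "Lg-lipschitz_on {p..q} g" by (rule C1_imp_lipschitz_on_interval[OF dg cg'])
  obtain Lh where Lh: "Lh-lipschitz_on {q..R2} h" by (rule C1_imp_lipschitz_on_interval[OF dh ch'])
  have "(max (max 0 Lg) Lh)-lipschitz_on {R1..R2} \<eta>" unfolding \<eta>_def
    by (intro lipschitz_on_concat_max Lg Lh lipschitz_on_constant) (use match ord in auto)
  moreover have "\<eta> R2 = 0" using match ord by (simp add: \<eta>_def)
  ultimately have ge: "0 \<le> (LINT r:{R1..R2}|lebesgue. F r)"
    using HL unfolding F_def by blast
  have cg: "continuous_on {p..q} g" and ch: "continuous_on {q..R2} h"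
    using Lg Lh lipschitz_on_continuous_on by blast+
  have cw1: "continuous_on {R1..p} w" "continuous_on {p..q} w" "continuous_on {q..R2} w"
    using ord by (auto intro: continuous_on_subset[OF cw])
  have deriv_eq: "deriv \<eta> r = k' r"
    if "a < r" "r < b" "\<And>x. a < x \<Longrightarrow> x < b \<Longrightarrow> \<eta> x = k x"
      "(k has_real_derivative k' r) (at r within {a..b})" for k k' a b r
  proof -
    have "(k has_real_derivative k' r) (at r)"
      using that(4) at_within_Icc_at[OF that(1,2)] by simp
    then have "(\<eta> has_real_derivative k' r) (at r)"
      by (rule has_field_derivative_transform_within_open[of _ _ _ "{a<..<b}"]) (use that in auto)
    then show ?thesis by (rule DERIV_imp_deriv)
  qed
  have 1: "F r = r ^ (N - 1) * (w r)\<^sup>2 * (0\<^sup>2 - (real N - 1) / r\<^sup>2 * c\<^sup>2)" if "R1 < r" "r < p" for r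
  proof -
    have "deriv \<eta> r = 0" using that ord
      by (intro deriv_eq[of R1 r p "\<lambda>_. c" "\<lambda>_. 0"]) (auto simp: \<eta>_def)
    moreover have "deriv U r = w r" using that ord by (intro dU) linarith
    ultimately show ?thesis using that ord by (simp add: F_def \<eta>_def)
  qed
  have 2: "F r = r ^ (N - 1) * (w r)\<^sup>2 * ((g' r)\<^sup>2 - (real N - 1) / r\<^sup>2 * (g r)\<^sup>2)"
    if "p < r" "r < q" for r
  proof -
    have "deriv \<eta> r = g' r" using that ord
      by (intro deriv_eq[of p r q g g'] dg) (auto simp: \<eta>_def)
    moreover have "deriv U r = w r" using that ord by (intro dU) linarith
    ultimately show ?thesis using that ord by (simp add: F_def \<eta>_def)
  qed
  have 3: "F r = r ^ (N - 1) * (w r)\<^sup>2 * ((h' r)\<^sup>2 - (real N - 1) / r\<^sup>2 * (h r)\<^sup>2)"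
    if "q < r" "r < R2" for r
  proof -
    have "deriv \<eta> r = h' r" using that ord
      by (intro deriv_eq[of q r R2 h h'] dh) (auto simp: \<eta>_def)
    moreover have "deriv U r = w r" using that ord by (intro dU) linarith
    ultimately show ?thesis using that ord by (simp add: F_def \<eta>_def)
  qed
  have c1: "continuous_on {R1..p} (\<lambda>r. r ^ (N - 1) * (w r)\<^sup>2 * (0\<^sup>2 - (real N - 1) / r\<^sup>2 * c\<^sup>2))"
    (is "continuous_on _ ?G1")
    using ord by (intro continuous_intros cw1) auto
  have c2: "continuous_on {p..q}
      (\<lambda>r. r ^ (N - 1) * (w r)\<^sup>2 * ((g' r)\<^sup>2 - (real N - 1) / r\<^sup>2 * (g r)\<^sup>2))"
    (is "continuous_on _ ?G2")
    using ord by (intro continuous_intros cw1 cg cg') auto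
  have c3: "continuous_on {q..R2}
      (\<lambda>r. r ^ (N - 1) * (w r)\<^sup>2 * ((h' r)\<^sup>2 - (real N - 1) / r\<^sup>2 * (h r)\<^sup>2))"
    (is "continuous_on _ ?G3")
    using ord by (intro continuous_intros cw1 ch ch') auto
  have I1: "F absolutely_integrable_on {R1..p}" "integral {R1..p} F = integral {R1..p} ?G1"
    by (rule integral_eq_off_endpoints[OF c1], erule (1) 1)+
  have I2: "F absolutely_integrable_on {p..q}" "integral {p..q} F = integral {p..q} ?G2"
    by (rule integral_eq_off_endpoints[OF c2], erule (1) 2)+
  have I3: "F absolutely_integrable_on {q..R2}" "integral {q..R2} F = integral {q..R2} ?G3"
    by (rule integral_eq_off_endpoints[OF c3], erule (1) 3)+
  have ai: "F absolutely_integrable_on {R1..q}"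
    by (rule absolutely_integrable_on_combine[OF I1(1) I2(1) ord(2,3)])
  have ai': "F absolutely_integrable_on {R1..R2}"
    by (rule absolutely_integrable_on_combine[OF ai I3(1)]) (use ord in linarith)+
  have "(LINT r:{R1..R2}|lebesgue. F r) = integral {R1..R2} F"
    by (rule set_lebesgue_integral_eq_integral(2)[OF ai'])
  also have "\<dots> = integral {R1..q} F + integral {q..R2} F"
    by (rule Henstock_Kurzweil_Integration.integral_combine[symmetric, OF _ _
          set_lebesgue_integral_eq_integral(1)[OF ai']]) (use ord in linarith)+
  also have "integral {R1..q} F = integral {R1..p} F + integral {p..q} F"
    by (rule Henstock_Kurzweil_Integration.integral_combine[symmetric, OF ord(2,3)
          set_lebesgue_integral_eq_integral(1)[OF ai]])
  finally show ?thesis using ge I1(2) I2(2) I3(2) by linarith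
qed

subsection \<open>Nonvanishing of the radial derivative\<close>

text \<open>Uniqueness for the Cauchy problem with data (U r0, 0) at an equilibrium, by Gronwall:
  with c = U r0, the quantity E = (U - c)^2 + w^2 vanishes at r0 and satisfies |E'| \<le> K E on the
  compact interval between r and r0, because \<open>f\<close> is Lipschitz on the bounded range of
  \<open>U\<close> there and k / s \<le> k.\<close>

lemma radial_ode_stationary:
  fixes f U w w' :: "real \<Rightarrow> real"
  assumes f: "f C1_differentiable_on UNIV" and k: "0 \<le> k"
    and dU: "\<And>r. r > 1 \<Longrightarrow> (U has_real_derivative w r) (at r)"
    and dw: "\<And>r. r > 1 \<Longrightarrow> (w has_real_derivative w' r) (at r)"
    and ode: "\<And>r. r > 1 \<Longrightarrow> - (w' r + k / r * w r) = f (U r)"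
    and r0: "r0 > 1" "w r0 = 0" "f (U r0) = 0" and r: "r > 1"
  shows "U r = U r0"
proof -
  let ?a = "min r r0" and ?b = "max r r0"
  have I: "s > 1" if "s \<in> {?a..?b}" for s using that r r0 by auto
  have "continuous_on {?a..?b} U"
    using dU I by (intro continuous_at_imp_continuous_on ballI DERIV_isCont) blast
  then have "bounded (U ` {?a..?b})"
    by (intro compact_imp_bounded compact_continuous_image compact_Icc)
  then obtain B where "\<forall>y \<in> U ` {?a..?b}. norm y \<le> B" unfolding bounded_iff by blast
  then have B: "\<bar>U s\<bar> \<le> B" if "s \<in> {?a..?b}" for s using that by (simp only: real_norm_def ball_simps)
  obtain D where D: "\<And>x. (f has_vector_derivative D x) (at x)" "continuous_on UNIV D"
    using f by (auto simp: C1_differentiable_on_def)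
  obtain L where L: "L-lipschitz_on {-B..B} f"
  proof (rule C1_imp_lipschitz_on_interval)
    show "(f has_real_derivative D x) (at x within {-B..B})" for x
      using D(1)[of x] by (auto simp: has_real_derivative_iff_has_vector_derivative
          intro: has_vector_derivative_at_within)
    show "continuous_on {-B..B} D" using D(2) continuous_on_subset by blast
  qed
  define c where "c = U r0"
  \<comment> \<open>The summands bound the three terms of E': 1 for 2 (U - c) w, \<open>L\<close>
    for the nonlinearity and 2 k for the first-order term of the equation.\<close>
  define K where "K = 1 + L + 2 * k"
  define E where "E s = (U s - c)\<^sup>2 + (w s)\<^sup>2" for s
  define E' where "E' s = 2 * (U s - c) * w s + 2 * w s * w' s" for s
  have dE: "(E has_real_derivative E' s) (at s)" if "s > 1" for s
    unfolding E_def E'_def using dU[OF that] dw[OF that]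
    by (auto intro!: derivative_eq_intros)
  have L0: "0 \<le> L" using L lipschitz_on_nonneg by blast
  have E0: "E r0 = 0" by (simp add: E_def c_def r0)
  have bound: "\<bar>E' s\<bar> \<le> K * E s" if s: "s \<in> {?a..?b}" for s
  proof -
    have "dist (f (U s)) (f c) \<le> L * dist (U s) c"
      using B[OF s] B[of r0] by (intro lipschitz_onD[OF L]) (auto simp: c_def abs_le_iff)
    then have fb: "\<bar>f (U s)\<bar> \<le> L * \<bar>U s - c\<bar>" using r0 by (simp add: c_def dist_real_def)
    have s1: "s > 1" using I[OF s] .
    have am: "2 * (\<bar>U s - c\<bar> * \<bar>w s\<bar>) \<le> E s"
      using sum_squares_bound[of "\<bar>U s - c\<bar>" "\<bar>w s\<bar>"] by (simp add: E_def)
    have "k / s \<le> k" using s1 k by (simp add: field_simps mult_le_cancel_left1)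
    then have kw: "k / s * (w s)\<^sup>2 \<le> k * E s"
      using k s1 by (intro mult_mono) (auto simp: E_def)
    have "E' s = 2 * ((U s - c) * w s) - 2 * (f (U s) * w s) - 2 * (k / s * (w s)\<^sup>2)"
    proof -
      have "w' s = - f (U s) - k / s * w s" using ode[OF s1] by simp
      show ?thesis unfolding E'_def \<open>w' s = _\<close> by (simp add: algebra_simps power2_eq_square)
    qed
    then have "\<bar>E' s\<bar> \<le> 2 * \<bar>(U s - c) * w s\<bar> + 2 * \<bar>f (U s) * w s\<bar> + 2 * \<bar>k / s * (w s)\<^sup>2\<bar>"
      by linarith
    also have "\<bar>k / s * (w s)\<^sup>2\<bar> = k / s * (w s)\<^sup>2" using k s1 by simp
    also have "\<bar>f (U s) * w s\<bar> \<le> L * \<bar>U s - c\<bar> * \<bar>w s\<bar>"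
      unfolding abs_mult by (intro mult_right_mono fb) simp
    also have "2 * \<bar>(U s - c) * w s\<bar> + 2 * (L * \<bar>U s - c\<bar> * \<bar>w s\<bar>) + 2 * (k / s * (w s)\<^sup>2)
      = 2 * (\<bar>U s - c\<bar> * \<bar>w s\<bar>) + L * (2 * (\<bar>U s - c\<bar> * \<bar>w s\<bar>)) + 2 * (k / s * (w s)\<^sup>2)"
      by (simp add: abs_mult)
    also have "\<dots> \<le> E s + L * E s + 2 * (k * E s)"
      by (intro add_mono mult_left_mono am kw L0) auto
    finally show ?thesis by (simp add: K_def algebra_simps)
  qed
  have "E r \<le> 0"
  \<comment> \<open>The integrating factor depends on the direction: exp(-K s) E is nonincreasing to
    the right of r0, exp(K s) E nondecreasing to the left of it.\<close>
  proof (cases "r0 \<le> r")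
    case True
    have "exp (- K * r) * E r \<le> exp (- K * r0) * E r0"
    proof (rule DERIV_nonpos_imp_nonincreasing[OF True])
      fix s assume s: "r0 \<le> s" "s \<le> r"
      then have "s \<in> {?a..?b}" by auto
      note b = bound[OF this] and d = dE[OF I[OF this]]
      have "((\<lambda>s. exp (- K * s) * E s) has_real_derivative exp (- K * s) * (E' s - K * E s)) (at s)"
        using d by (auto intro!: derivative_eq_intros simp: algebra_simps)
      moreover have "exp (- K * s) * (E' s - K * E s) \<le> 0"
        using b by (intro mult_nonneg_nonpos) auto
      ultimately show "\<exists>y. ((\<lambda>s. exp (- K * s) * E s) has_real_derivative y) (at s) \<and> y \<le> 0" by blast
    qed
    then show ?thesis by (simp add: E0 mult_le_0_iff not_le)
  next
    case False
    have "exp (K * r) * E r \<le> exp (K * r0) * E r0"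
    proof (rule DERIV_nonneg_imp_nondecreasing[where a = r and b = r0])
      fix s assume s: "r \<le> s" "s \<le> r0"
      then have "s \<in> {?a..?b}" by auto
      note b = bound[OF this] and d = dE[OF I[OF this]]
      have "((\<lambda>s. exp (K * s) * E s) has_real_derivative exp (K * s) * (E' s + K * E s)) (at s)"
        using d by (auto intro!: derivative_eq_intros simp: algebra_simps)
      moreover have "exp (K * s) * (E' s + K * E s) \<ge> 0"
        using b by (intro mult_nonneg_nonneg) auto
      ultimately show "\<exists>y. ((\<lambda>s. exp (K * s) * E s) has_real_derivative y) (at s) \<and> 0 \<le> y" by blast
    qed (use False in simp)
    then show ?thesis by (simp add: E0 mult_le_0_iff not_le)
  qed
  then have "(U r - c)\<^sup>2 \<le> 0" unfolding E_def using zero_le_power2[of "w r"] by linarith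
  then show ?thesis by (simp add: c_def)
qed

text \<open>A cutoff falling linearly from 1 to 0 on [R2 - \<epsilon>, R2] has \<eta>'^2 =
  \<epsilon>^(-2), but w^2 = O(\<epsilon>^2) near a zero at which \<open>w\<close> is
  differentiable; over a length \<epsilon> the cost is O(\<epsilon>). The constant part loses at
  least a fixed amount unless \<open>w\<close> vanishes.\<close>

lemma H_L_zero_imp_vanish:
  fixes w :: "real \<Rightarrow> real"
  assumes HL: "\<And>\<eta>. (\<exists>C. C-lipschitz_on {R1..R2} \<eta>) \<Longrightarrow> \<eta> R2 = 0 \<Longrightarrow>
        (LINT r:{R1..R2}|lebesgue.
           r ^ (N - 1) * (deriv U r)\<^sup>2 * ((deriv \<eta> r)\<^sup>2 - (real N - 1) / r\<^sup>2 * (\<eta> r)\<^sup>2)) \<ge> 0"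
    and N: "N \<ge> 2" and ord: "1 \<le> R1" "R1 < R2"
    and cw: "continuous_on {R1..R2} w" and dU: "\<And>r. r > 1 \<Longrightarrow> deriv U r = w r"
    and dw: "(w has_real_derivative d) (at R2)" and w0: "w R2 = 0"
    and r: "r \<in> {R1..R2}"
  shows "w r = 0"
proof (rule ccontr)
  assume wr: "w r \<noteq> 0"
  then have "r < R2" using w0 r by (cases "r = R2") auto
  \<comment> \<open>Stopping short of R2 but beyond r makes the loss \<open>I\<close> below positive
    and independent of \<epsilon>.\<close>
  define b where "b = (r + R2) / 2"
  have b: "R1 < b" "b < R2" "r \<le> b" using \<open>r < R2\<close> r by (auto simp: b_def)
  define J where "J s = s ^ (N - 1) * (w s)\<^sup>2 * ((real N - 1) / s\<^sup>2)" for s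
  have cJ: "continuous_on {R1..R2} J"
    unfolding J_def using ord by (intro continuous_intros cw) auto
  have J0: "0 \<le> J s" if "R1 \<le> s" for s
    using that ord N by (simp add: J_def)
  define I where "I = integral {R1..b} J"
  have "J r \<noteq> 0" using wr r ord N by (auto simp: J_def)
  moreover have cJb: "continuous_on {R1..b} J" by (rule continuous_on_subset[OF cJ]) (use b in auto)
  ultimately have "I \<noteq> 0"
    using integral_eq_0_iff[OF cJb b(1)] J0 b r unfolding I_def by auto
  moreover have "0 \<le> I" unfolding I_def
    by (intro integral_nonneg integrable_continuous_real cJb J0) auto
  ultimately have I: "0 < I" by simp
  define C where "C = R2 ^ (N - 1) * (\<bar>d\<bar> + 1)\<^sup>2"
  have C: "0 < C" using ord by (simp add: C_def add_nonneg_pos)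
  have "((\<lambda>s. w s / (s - R2)) \<longlongrightarrow> d) (at R2)"
    using dw w0 by (simp add: has_field_derivative_iff)
  then have "\<forall>\<^sub>F s in at R2. dist (w s / (s - R2)) d < 1" by (rule tendstoD) simp
  then obtain \<delta> where \<delta>: "\<delta> > 0"
    and near: "\<And>s. s \<noteq> R2 \<Longrightarrow> dist s R2 < \<delta> \<Longrightarrow> dist (w s / (s - R2)) d < 1"
    by (auto simp: eventually_at)
  \<comment> \<open>The three bounds serve in turn to keep |w s / (s - R2)| below |d| + 1, to leave
    [R1, b] inside the constant piece, and to push the cost C \<epsilon> below
    \<open>I\<close>.\<close>
  define \<epsilon> where "\<epsilon> = min (min (\<delta> / 2) (R2 - b)) (I / (2 * C))"
  have \<epsilon>: "0 < \<epsilon>" "\<epsilon> < \<delta>" "b \<le> R2 - \<epsilon>" "C * \<epsilon> < I"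
  proof -
    have "C * \<epsilon> \<le> C * (I / (2 * C))" using C by (intro mult_left_mono) (auto simp: \<epsilon>_def)
    also have "\<dots> = I / 2" using C by simp
    finally show "C * \<epsilon> < I" using I by linarith
    show "0 < \<epsilon>" using \<delta> b C I by (simp add: \<epsilon>_def)
    show "\<epsilon> < \<delta>" "b \<le> R2 - \<epsilon>" using \<delta> unfolding \<epsilon>_def by linarith+
  qed
  have wb: "(w s)\<^sup>2 \<le> (\<bar>d\<bar> + 1)\<^sup>2 * \<epsilon>\<^sup>2" if s: "s \<in> {R2 - \<epsilon>..R2}" for s
  proof (cases "s = R2")
    case False
    have "\<bar>w s / (s - R2)\<bar> \<le> \<bar>d\<bar> + 1"
    proof -
      have "dist s R2 < \<delta>" using s \<epsilon> by (simp add: dist_real_def)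
      from near[OF False this] show ?thesis unfolding dist_real_def by linarith
    qed
    then have "\<bar>w s\<bar> \<le> (\<bar>d\<bar> + 1) * \<bar>s - R2\<bar>" using False by (simp add: field_simps)
    also have "\<dots> \<le> (\<bar>d\<bar> + 1) * \<epsilon>" using s by (intro mult_left_mono) auto
    finally have "\<bar>w s\<bar>\<^sup>2 \<le> ((\<bar>d\<bar> + 1) * \<epsilon>)\<^sup>2" by (intro power_mono) auto
    then show ?thesis by (simp add: power_mult_distrib)
  qed (simp add: w0)
  let ?p = "R2 - \<epsilon>"
  let ?h = "\<lambda>s. (R2 - s) / \<epsilon>" and ?h' = "\<lambda>s. - 1 / \<epsilon>"
  let ?H = "\<lambda>s. s ^ (N - 1) * (w s)\<^sup>2 * ((?h' s)\<^sup>2 - (real N - 1) / s\<^sup>2 * (?h s)\<^sup>2)"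
  have p: "R1 \<le> ?p" "?p < R2" using \<epsilon> b by auto
  \<comment> \<open>The middle piece is degenerate and its integral is 0.\<close>
  have "0 \<le> integral {R1..?p} (\<lambda>r. r ^ (N - 1) * (w r)\<^sup>2 * (0\<^sup>2 - (real N - 1) / r\<^sup>2 * 1\<^sup>2))
    + integral {?p..?p} (\<lambda>r. r ^ (N - 1) * (w r)\<^sup>2 * (((\<lambda>_. 0) r)\<^sup>2 - (real N - 1) / r\<^sup>2 * ((\<lambda>_. 1) r)\<^sup>2))
    + integral {?p..R2} ?H"
    by (rule H_L_glued[OF HL ord(1) p(1) order_refl p(2) cw dU])
      (use \<epsilon> in \<open>auto intro!: derivative_eq_intros continuous_intros\<close>)
  also have "(\<lambda>r. r ^ (N - 1) * (w r)\<^sup>2 * (0\<^sup>2 - (real N - 1) / r\<^sup>2 * 1\<^sup>2)) = (\<lambda>r. - J r)"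
    by (auto simp: J_def fun_eq_iff field_simps)
  finally have "integral {R1..?p} J \<le> integral {?p..R2} ?H" by simp
  moreover have "I \<le> integral {R1..?p} J" unfolding I_def
    using \<epsilon> J0 by (intro integral_subset_le integrable_continuous_real
        continuous_on_subset[OF cJ]) auto
  moreover have "integral {?p..R2} ?H \<le> integral {?p..R2} (\<lambda>s. C)"
  proof (rule integral_le)
    show "?H integrable_on {?p..R2}"
      using ord p by (intro integrable_continuous_real continuous_intros
          continuous_on_subset[OF cw]) auto
    fix s assume s: "s \<in> {?p..R2}"
    have s0: "0 < s" using s p ord by auto
    have "?H s \<le> s ^ (N - 1) * (w s)\<^sup>2 * (?h' s)\<^sup>2"
      using s0 N by (intro mult_left_mono) auto
    also have "\<dots> \<le> R2 ^ (N - 1) * ((\<bar>d\<bar> + 1)\<^sup>2 * \<epsilon>\<^sup>2) * (?h' s)\<^sup>2"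
      using s s0 by (intro mult_right_mono mult_mono power_mono wb) auto
    also have "\<dots> = C" using \<epsilon> by (simp add: C_def power_divide)
    finally show "?H s \<le> C" .
  qed (intro integrable_continuous_real continuous_on_const)
  moreover have "integral {?p..R2} (\<lambda>s. C) = C * \<epsilon>" using \<epsilon> by simp
  ultimately show False using \<epsilon>(4) by linarith
qed

subsection \<open>Lower bounds from $(H_L)$\<close>

text \<open>\<open>K\<close> is the deficit of the constant piece. It depends on R1 and
  \<open>w\<close> but not on R or on the tail \<open>h\<close>, and this uniformity is what later
  produces a rate in R.\<close>

lemma H_L_energy_bound:
  fixes w :: "real \<Rightarrow> real"
  assumes HL: "\<And>R2 \<eta>. R2 > R1 \<Longrightarrow> (\<exists>C. C-lipschitz_on {R1..R2} \<eta>) \<Longrightarrow> \<eta> R2 = 0 \<Longrightarrow>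
        (LINT r:{R1..R2}|lebesgue.
           r ^ (N - 1) * (deriv U r)\<^sup>2 * ((deriv \<eta> r)\<^sup>2 - (real N - 1) / r\<^sup>2 * (\<eta> r)\<^sup>2)) \<ge> 0"
    and N: "N \<ge> 2" and R1: "1 \<le> R1"
    and cw: "continuous_on {1..} w" and dU: "\<And>r. r > 1 \<Longrightarrow> deriv U r = w r"
    and nz: "\<And>r. r > R1 \<Longrightarrow> w r \<noteq> 0"
  obtains K where "K > 0"
    "\<And>R h h'. R \<ge> R1 + 1 \<Longrightarrow>
       (\<And>r. r \<in> {R..2 * R} \<Longrightarrow> (h has_real_derivative h' r) (at r within {R..2 * R})) \<Longrightarrow>
       continuous_on {R..2 * R} h' \<Longrightarrow> h R = R powr (- sqrt (real N - 1)) \<Longrightarrow> h (2 * R) = 0 \<Longrightarrow>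
       K \<le> integral {R..2 * R} (\<lambda>r. r ^ (N - 1) * (w r)\<^sup>2 * (h' r)\<^sup>2)"
proof -
  let ?a = "sqrt (real N - 1)"
  \<comment> \<open>Any fixed point beyond R1 would do: \<open>w p\<close> is nonzero, so the
    deficit over [R1, p] is strictly positive.\<close>
  define p where "p = R1 + 1"
  define c where "c = p powr (- ?a)"
  define J where "J r = r ^ (N - 1) * (w r)\<^sup>2 * ((real N - 1) / r\<^sup>2 * c\<^sup>2)" for r
  have cwI: "continuous_on {x..y} w" if "1 \<le> x" for x y
    by (rule continuous_on_subset[OF cw]) (use that in auto)
  have cJ: "continuous_on {R1..p} J"
    unfolding J_def using R1 by (intro continuous_intros cwI) auto
  have J0: "0 \<le> J r" if "r \<in> {R1..p}" for r using that R1 N by (simp add: J_def)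
  define K where "K = integral {R1..p} J"
  have "c > 0" using R1 by (simp add: c_def p_def)
  then have "J p \<noteq> 0" using nz[of p] R1 N by (simp add: J_def p_def)
  then have "K \<noteq> 0"
    using integral_eq_0_iff[OF cJ _ J0] by (auto simp: K_def p_def)
  moreover have "0 \<le> K" unfolding K_def
    by (intro integral_nonneg integrable_continuous_real cJ J0)
  ultimately have K: "0 < K" by simp
  have aa: "?a\<^sup>2 = real N - 1" using N by simp
  show thesis
  proof (rule that[OF K])
    fix R h h'
    assume R: "R \<ge> R1 + 1"
      and dh: "\<And>r. r \<in> {R..2 * R} \<Longrightarrow> (h has_real_derivative h' r) (at r within {R..2 * R})"
      and ch': "continuous_on {R..2 * R} h'" and hR: "h R = R powr (- ?a)" and h0: "h (2 * R) = 0"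
    have pos: "1 \<le> R" "R < 2 * R" "R1 < 2 * R" using R R1 by auto
    have p: "R1 \<le> p" "p \<le> R" using R by (auto simp: p_def)
    let ?g = "\<lambda>r. r powr (- ?a)" and ?g' = "\<lambda>r. - ?a * r powr (- ?a) / r"
    let ?H = "\<lambda>r. r ^ (N - 1) * (w r)\<^sup>2 * ((h' r)\<^sup>2 - (real N - 1) / r\<^sup>2 * (h r)\<^sup>2)"
    let ?M = "\<lambda>r. r ^ (N - 1) * (w r)\<^sup>2 * ((?g' r)\<^sup>2 - (real N - 1) / r\<^sup>2 * (?g r)\<^sup>2)"
    have "0 \<le> integral {R1..p} (\<lambda>r. r ^ (N - 1) * (w r)\<^sup>2 * (0\<^sup>2 - (real N - 1) / r\<^sup>2 * c\<^sup>2))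
      + integral {p..R} ?M + integral {R..2 * R} ?H"
    proof (rule H_L_glued[OF HL R1 p pos(2) cwI[OF R1] dU _ _ dh ch'])
      fix r assume r: "r \<in> {p..R}"
      then have "r > 0" using R1 by (simp add: p_def)
      then have "(?g has_real_derivative - ?a * r powr (- ?a - 1)) (at r)"
        by (rule has_real_derivative_powr)
      moreover have "- ?a * r powr (- ?a - 1) = ?g' r"
        using \<open>r > 0\<close> by (simp add: powr_diff)
      ultimately show "(?g has_real_derivative ?g' r) (at r within {p..R})"
        by (metis has_field_derivative_at_within)
    next
      show "continuous_on {p..R} ?g'" using R1 by (intro continuous_intros) (auto simp: p_def)
    qed (use pos hR h0 in \<open>auto simp: c_def\<close>)
    also have "integral {p..R} ?M = integral {p..R} (\<lambda>_. 0)"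
    proof (rule integral_cong)
      fix r assume "r \<in> {p..R}"
      have "(?g' r)\<^sup>2 = ?a\<^sup>2 * (?g r)\<^sup>2 / r\<^sup>2" by (simp add: power_divide power_mult_distrib)
      then show "?M r = 0" unfolding aa by simp
    qed
    also have "(\<lambda>r. r ^ (N - 1) * (w r)\<^sup>2 * (0\<^sup>2 - (real N - 1) / r\<^sup>2 * c\<^sup>2)) = (\<lambda>r. - J r)"
      by (simp add: J_def fun_eq_iff)
    finally have "K \<le> integral {R..2 * R} ?H" by (simp add: K_def)
    also have "\<dots> \<le> integral {R..2 * R} (\<lambda>r. r ^ (N - 1) * (w r)\<^sup>2 * (h' r)\<^sup>2)"
    proof (rule integral_le)
      have "continuous_on {R..2 * R} h"
        by (rule DERIV_continuous_on[OF dh])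
      then show "?H integrable_on {R..2 * R}"
        using pos ch' by (intro integrable_continuous_real continuous_intros cwI) auto
      show "(\<lambda>r. r ^ (N - 1) * (w r)\<^sup>2 * (h' r)\<^sup>2) integrable_on {R..2 * R}"
        using pos ch' by (intro integrable_continuous_real continuous_intros cwI) auto
      fix r assume "r \<in> {R..2 * R}"
      then show "?H r \<le> r ^ (N - 1) * (w r)\<^sup>2 * (h' r)\<^sup>2"
        using pos N by (intro mult_left_mono) auto
    qed
    finally show "K \<le> integral {R..2 * R} (\<lambda>r. r ^ (N - 1) * (w r)\<^sup>2 * (h' r)\<^sup>2)" .
  qed
qed

text \<open>The left side is the tangent at m of the convex function x^(-1/2). With x = s^2 and m =
  t^2 the claim reduces to (s - t)^2 (s + 2t) \<ge> 0.\<close>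

lemma tangent_inverse_sqrt:
  fixes x m :: real
  assumes "x > 0" "m > 0"
  shows "(3 - x / m) / (2 * sqrt m) \<le> 1 / sqrt x"
proof -
  define s t where "s = sqrt x" and "t = sqrt m"
  have st: "s > 0" "t > 0" "x = s\<^sup>2" "m = t\<^sup>2" using assms by (auto simp: s_def t_def)
  have "0 \<le> (s - t)\<^sup>2 * (s + 2 * t)" using st by simp
  also have "\<dots> = 2 * t ^ 3 - s * (3 * t\<^sup>2 - s\<^sup>2)"
    by (simp add: algebra_simps power2_eq_square power3_eq_cube)
  finally have "s * (3 * t\<^sup>2 - s\<^sup>2) / (2 * t ^ 3 * s) \<le> 2 * t ^ 3 / (2 * t ^ 3 * s)"
    using st by (intro divide_right_mono) auto
  moreover have "s * (3 * t\<^sup>2 - s\<^sup>2) / (2 * t ^ 3 * s) = (3 - x / m) / (2 * t)"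
    using st by (simp add: field_simps power2_eq_square power3_eq_cube)
  moreover have "2 * t ^ 3 / (2 * t ^ 3 * s) = 1 / s" using st by simp
  ultimately show ?thesis by (simp add: s_def t_def)
qed

text \<open>Here \<open>v\<close> stands for |w| and \<open>n\<close> for N - 1. The tail is a
  multiple of \<open>G\<close>, the integral of v^(-1/2) from r to 2R, which vanishes at 2R and
  whose squared derivative cancels one factor of v^2.\<close>

lemma energy_imp_increment:
  fixes v :: "real \<Rightarrow> real"
  assumes R: "1 \<le> R" and K: "K > 0" and cv: "continuous_on {R..2 * R} v"
    and pos: "\<And>r. r \<in> {R..2 * R} \<Longrightarrow> v r > 0"
    and energy: "\<And>h h'. (\<And>r. r \<in> {R..2 * R} \<Longrightarrow> (h has_real_derivative h' r) (at r within {R..2 * R})) \<Longrightarrow>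
       continuous_on {R..2 * R} h' \<Longrightarrow> h R = R powr (- a) \<Longrightarrow> h (2 * R) = 0 \<Longrightarrow>
       K \<le> integral {R..2 * R} (\<lambda>r. r ^ n * (v r)\<^sup>2 * (h' r)\<^sup>2)"
  shows "integral {R..2 * R} v \<ge> sqrt (K / 2 ^ n) * R powr ((3 - real n) / 2 + a)"
proof -
  let ?I = "{R..2 * R}"
  have nz: "v r \<noteq> 0" if "r \<in> ?I" for r using pos[OF that] by simp
  define g where "g r = 1 / sqrt (v r)" for r
  have cg: "continuous_on ?I g"
    unfolding g_def using pos by (intro continuous_intros cv) force+
  define G where "G r = integral {r..2 * R} g" for r
  define D where "D = integral ?I v"
  have iv: "v integrable_on ?I" and ig: "g integrable_on ?I"
    using cv cg by (auto intro: integrable_continuous_real)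
  have "D \<noteq> 0" using integral_eq_0_iff[OF cv] pos R unfolding D_def by (fastforce simp: less_imp_le)
  moreover have "D \<ge> 0" unfolding D_def
    by (intro integral_nonneg iv) (use pos in \<open>auto intro: less_imp_le\<close>)
  ultimately have D: "D > 0" by simp
  \<comment> \<open>The mean of \<open>v\<close> over the interval, whose length is R. With the
    tangent taken there, integrating the tangent bound is Jensen's inequality.\<close>
  define m where "m = D / R"
  have m: "m > 0" using D R by (simp add: m_def)
  have "R / sqrt m = integral ?I (\<lambda>r. (3 - v r / m) / (2 * sqrt m))"
  proof -
    have "((\<lambda>r. (3 - v r / m) / (2 * sqrt m)) has_integral (3 * R - D / m) / (2 * sqrt m)) ?I"
      using has_integral_const_real[of "3::real" R "2 * R"] R integrable_integral[OF iv]
      by (intro has_integral_divide has_integral_diff) (auto simp: D_def mult.commute)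
    then have "integral ?I (\<lambda>r. (3 - v r / m) / (2 * sqrt m)) = (3 * R - D / m) / (2 * sqrt m)"
      by (rule integral_unique)
    also have "D / m = R" using D R by (simp add: m_def)
    finally show ?thesis using m by simp
  qed
  also have "\<dots> \<le> G R" unfolding G_def g_def
    using cv pos m ig[unfolded g_def] nz
    by (intro integral_le tangent_inverse_sqrt integrable_continuous_real continuous_intros) auto
  finally have GR: "R / sqrt m \<le> G R" .
  then have G0: "G R > 0" using m R by (smt (verit) divide_pos_pos real_sqrt_gt_zero)
  have "(R / sqrt m)\<^sup>2 \<le> (G R)\<^sup>2" using GR m R by (intro power_mono) auto
  then have G2: "R ^ 3 / D \<le> (G R)\<^sup>2"
    using m R D by (simp add: power_divide m_def power2_eq_square power3_eq_cube)
  \<comment> \<open>Normalises the tail to the value R^(-a) at R, where it joins the middle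
    piece.\<close>
  let ?\<kappa> = "R powr (- a) / G R"
  have "K \<le> integral ?I (\<lambda>r. r ^ n * (v r)\<^sup>2 * (?\<kappa> * - g r)\<^sup>2)"
  proof (rule energy[of "\<lambda>r. ?\<kappa> * G r"])
    fix r assume "r \<in> ?I"
    then show "((\<lambda>r. ?\<kappa> * G r) has_real_derivative ?\<kappa> * - g r) (at r within ?I)"
      unfolding G_def by (intro DERIV_cmult integral_has_real_derivative' cg)
  next
    show "continuous_on ?I (\<lambda>r. ?\<kappa> * - g r)" by (intro continuous_intros cg)
  qed (use G0 in \<open>auto simp: G_def\<close>)
  also have "\<dots> \<le> integral ?I (\<lambda>r. (2 * R) ^ n * ?\<kappa>\<^sup>2 * v r)"
  proof (rule integral_le)
    show "(\<lambda>r. r ^ n * (v r)\<^sup>2 * (?\<kappa> * - g r)\<^sup>2) integrable_on ?I"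
      by (intro integrable_continuous_real continuous_intros cg cv)
    show "(\<lambda>r. (2 * R) ^ n * ?\<kappa>\<^sup>2 * v r) integrable_on ?I"
      by (intro integrable_continuous_real continuous_intros cv)
    fix r assume r: "r \<in> ?I"
    have "(g r)\<^sup>2 = 1 / v r" using pos[OF r] by (simp add: g_def power_divide)
    then have "r ^ n * (v r)\<^sup>2 * (?\<kappa> * - g r)\<^sup>2 = r ^ n * (?\<kappa>\<^sup>2 * v r)"
      using pos[OF r] by (simp add: power_mult_distrib power2_eq_square)
    also have "\<dots> \<le> (2 * R) ^ n * (?\<kappa>\<^sup>2 * v r)"
      using r R pos[OF r] by (intro mult_right_mono power_mono) auto
    finally show "r ^ n * (v r)\<^sup>2 * (?\<kappa> * - g r)\<^sup>2 \<le> (2 * R) ^ n * ?\<kappa>\<^sup>2 * v r" by simp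
  qed
  also have "\<dots> = (2 * R) ^ n * (R powr (- a))\<^sup>2 * D / (G R)\<^sup>2"
    by (simp add: D_def power_divide)
  \<comment> \<open>The Jensen bound \<open>G2\<close> brings in a second factor \<open>D\<close>;
    hence the square root in the conclusion.\<close>
  also have "\<dots> \<le> (2 * R) ^ n * (R powr (- a))\<^sup>2 * D / (R ^ 3 / D)"
    using D R G0 by (intro divide_left_mono G2 mult_pos_pos divide_pos_pos) auto
  also have "\<dots> = 2 ^ n * D\<^sup>2 * (R ^ n * (R powr (- a))\<^sup>2 / R ^ 3)"
    using D by (simp add: power_mult_distrib power2_eq_square)
  also have "R ^ n * (R powr (- a))\<^sup>2 / R ^ 3 = R powr (real n - 2 * a - 3)"
  proof -
    have "R ^ n = R powr real n" "R ^ 3 = R powr 3" using R powr_realpow[of R n] powr_realpow[of R 3] by auto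
    moreover have "(R powr (- a))\<^sup>2 = R powr (- 2 * a)"
      unfolding power2_eq_square powr_add[symmetric] by simp
    ultimately show ?thesis using R by (simp only: powr_add[symmetric] powr_diff[symmetric]) simp
  qed
  finally have "K / 2 ^ n \<le> D\<^sup>2 * R powr (real n - 2 * a - 3)" by (simp add: field_simps)
  \<comment> \<open>The multiplier is R to twice the target exponent, chosen to cancel the power of
    R on the right before taking roots.\<close>
  then have "K / 2 ^ n * R powr (2 * ((3 - real n) / 2 + a))
      \<le> D\<^sup>2 * R powr (real n - 2 * a - 3) * R powr (2 * ((3 - real n) / 2 + a))"
    by (intro mult_right_mono) auto
  also have "\<dots> = D\<^sup>2 * R powr (real n - 2 * a - 3 + 2 * ((3 - real n) / 2 + a))"
    by (simp only: mult.assoc powr_add)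
  also have "real n - 2 * a - 3 + 2 * ((3 - real n) / 2 + a) = 0" by (simp add: field_simps)
  also have "D\<^sup>2 * R powr 0 = D\<^sup>2" using R by simp
  finally have "sqrt (K / 2 ^ n * R powr (2 * ((3 - real n) / 2 + a))) \<le> D"
    using D by (intro real_le_lsqrt) auto
  moreover have "sqrt (R powr (2 * b)) = R powr b" for b
    by (rule real_sqrt_unique) (simp_all only: power2_eq_square powr_add[symmetric] mult_2 powr_ge_zero)
  ultimately show ?thesis by (simp only: real_sqrt_mult D_def)
qed

subsection \<open>Growth from dyadic increments\<close>

lemma mono_tendsto_Sup_ereal:
  fixes V :: "real \<Rightarrow> real"
  assumes mono: "\<And>x y. a \<le> x \<Longrightarrow> x \<le> y \<Longrightarrow> V x \<le> V y"
  shows "((\<lambda>r. ereal (V r)) \<longlongrightarrow> (SUP r\<in>{a..}. ereal (V r))) at_top" (is "(_ \<longlongrightarrow> ?L) _")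
proof (rule order_tendstoI)
  fix y assume "y < ?L"
  then obtain r where r: "r \<ge> a" "y < ereal (V r)" by (auto simp: less_SUP_iff)
  show "\<forall>\<^sub>F s in at_top. y < ereal (V s)"
    using eventually_ge_at_top[of r]
  proof eventually_elim
    case (elim s)
    then have "ereal (V r) \<le> ereal (V s)" using mono r by simp
    with r show ?case by order
  qed
next
  fix y assume y: "?L < y"
  show "\<forall>\<^sub>F s in at_top. ereal (V s) < y"
    using eventually_ge_at_top[of a]
  proof eventually_elim
    case (elim s)
    then have "ereal (V s) \<le> ?L" by (intro SUP_upper) auto
    with y show ?case by order
  qed
qed

text \<open>Indexed by the sign of the exponent instead of the dimension, so that growth and
  reflection arguments concern a real \<beta> only; \<open>exponent_sign\<close> translates
  back.\<close>

definition growth_conclusion :: "real \<Rightarrow> ereal \<Rightarrow> (real \<Rightarrow> real) \<Rightarrow> bool" where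
  "growth_conclusion \<beta> l V \<longleftrightarrow> (\<exists>M>0. \<exists>r0\<ge>1.
     (\<beta> > 0 \<longrightarrow> (\<forall>r\<ge>r0. \<bar>V r\<bar> \<ge> M * r powr \<beta>)) \<and>
     (\<beta> = 0 \<longrightarrow> (\<forall>r\<ge>r0. \<bar>V r\<bar> \<ge> M * ln r)) \<and>
     (\<beta> < 0 \<longrightarrow> (\<forall>r\<ge>r0. \<bar>ereal (V r) - l\<bar> \<ge> ereal (M * r powr \<beta>))))"

text \<open>The single increment over [r/2, r] already has the right order. \<open>V a\<close> may
  be negative, and half of the constant is spent on absorbing it.\<close>

lemma growth_positive:
  fixes V :: "real \<Rightarrow> real"
  assumes mono: "\<And>x y. a \<le> x \<Longrightarrow> x \<le> y \<Longrightarrow> V x \<le> V y" and C: "C > 0" and a: "a \<ge> 1"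
    and inc: "\<And>R. R \<ge> a \<Longrightarrow> V (2 * R) - V R \<ge> C * R powr \<beta>" and \<beta>: "\<beta> > 0"
  shows "\<exists>M>0. \<exists>r0\<ge>1. \<forall>r\<ge>r0. V r \<ge> M * r powr \<beta>"
proof -
  define M where "M = C / 2 powr \<beta>"
  have M: "M > 0" using C by (simp add: M_def)
  have "filterlim (\<lambda>r. M / 2 * r powr \<beta>) at_top at_top"
    using M \<beta> by real_asymp
  then have "\<forall>\<^sub>F r in at_top. M / 2 * r powr \<beta> \<ge> - V a"
    by (rule filterlim_at_top[THEN iffD1, rule_format])
  then obtain r1 where r1: "\<And>r. r \<ge> r1 \<Longrightarrow> M / 2 * r powr \<beta> \<ge> - V a"
    by (auto simp: eventually_at_top_linorder)
  have "V r \<ge> M / 2 * r powr \<beta>" if r: "r \<ge> max r1 (2 * a)" for r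
  proof -
    have "V r - V (r / 2) \<ge> C * (r / 2) powr \<beta>" using inc[of "r / 2"] r by simp
    also have "C * (r / 2) powr \<beta> = M * r powr \<beta>"
      using r a by (simp add: M_def powr_divide)
    finally have "M * r powr \<beta> \<le> V r - V (r / 2)" .
    moreover have "V a \<le> V (r / 2)" using mono r by simp
    ultimately show ?thesis using r1[of r] r by simp
  qed
  then show ?thesis using M a by (intro exI[of _ "M / 2"] conjI exI[of _ "max r1 (2 * a)"]) auto
qed

text \<open>For \<beta> = 0 one increment gives only a constant, so all doublings from a up to r,
  about log 2 (r/a) of them, are summed.\<close>

lemma growth_logarithmic:
  fixes V :: "real \<Rightarrow> real"
  assumes mono: "\<And>x y. a \<le> x \<Longrightarrow> x \<le> y \<Longrightarrow> V x \<le> V y" and C: "C > 0" and a: "a \<ge> 1"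
    and inc: "\<And>R. R \<ge> a \<Longrightarrow> V (2 * R) - V R \<ge> C"
  shows "\<exists>M>0. \<exists>r0\<ge>1. \<forall>r\<ge>r0. V r \<ge> M * ln r"
proof -
  have iter: "V (2 ^ k * a) \<ge> V a + real k * C" for k
  proof (induction k)
    case (Suc k)
    have "1 * a \<le> 2 ^ k * a" using a by (intro mult_right_mono) auto
    then have "V (2 * (2 ^ k * a)) - V (2 ^ k * a) \<ge> C" by (intro inc) simp
    with Suc show ?case by (simp add: algebra_simps)
  qed simp
  define M where "M = C / ln 2"
  have M: "M > 0" using C by (simp add: M_def)
  have "filterlim (\<lambda>r. M / 2 * ln r) at_top at_top"
    using M by real_asymp
  then have "\<forall>\<^sub>F r in at_top. M / 2 * ln r \<ge> M * ln a + C - V a"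
    by (rule filterlim_at_top[THEN iffD1, rule_format])
  then obtain r1 where r1: "\<And>r. r \<ge> r1 \<Longrightarrow> M / 2 * ln r \<ge> M * ln a + C - V a"
    by (auto simp: eventually_at_top_linorder)
  have "V r \<ge> M / 2 * ln r" if r: "r \<ge> max r1 a" for r
  proof -
    define t where "t = log 2 (r / a)"
    have t: "t \<ge> 0" "2 powr t = r / a" using r a by (auto simp: t_def)
    \<comment> \<open>Rounding down loses at most one increment \<open>C\<close>, which the choice
      of \<open>r1\<close> has already absorbed.\<close>
    define k where "k = nat \<lfloor>t\<rfloor>"
    have k: "real k \<le> t" "t \<le> real k + 1" using t by (auto simp: k_def)
    have "2 ^ k = 2 powr real k" by (simp add: powr_realpow)
    also have "\<dots> \<le> 2 powr t" using k by simp
    finally have "2 ^ k * a \<le> r" using t a by (simp add: field_simps)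
    moreover have "1 * a \<le> 2 ^ k * a" using a by (intro mult_right_mono) auto
    ultimately have "V (2 ^ k * a) \<le> V r" using mono by simp
    then have "V a + real k * C \<le> V r" using iter[of k] by simp
    moreover have "(t - 1) * C \<le> real k * C" using k C by (intro mult_right_mono) auto
    moreover have "t * C = M * ln r - M * ln a"
      using r a by (simp add: t_def M_def log_def ln_div field_simps)
    ultimately show ?thesis using r1[of r] r by (simp add: algebra_simps)
  qed
  then show ?thesis using M a by (intro exI[of _ "M / 2"] conjI exI[of _ "max r1 a"]) auto
qed

lemma growth_of_increments:
  fixes V :: "real \<Rightarrow> real"
  assumes mono: "\<And>x y. a \<le> x \<Longrightarrow> x \<le> y \<Longrightarrow> V x \<le> V y" and C: "C > 0" and a: "a \<ge> 1"
    and inc: "\<And>R. R \<ge> a \<Longrightarrow> V (2 * R) - V R \<ge> C * R powr \<beta>"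
  obtains l where "((\<lambda>r. ereal (V r)) \<longlongrightarrow> l) at_top" "growth_conclusion \<beta> l V"
proof
  let ?l = "SUP r\<in>{a..}. ereal (V r)"
  show "((\<lambda>r. ereal (V r)) \<longlongrightarrow> ?l) at_top" by (rule mono_tendsto_Sup_ereal[OF mono])
  consider "\<beta> > 0" | "\<beta> = 0" | "\<beta> < 0" by linarith
  then show "growth_conclusion \<beta> ?l V"
  proof cases
    case 1
    from growth_positive[of a V C \<beta>, OF mono C a inc 1] obtain M r0
      where "M > 0" "r0 \<ge> 1" "\<forall>r\<ge>r0. V r \<ge> M * r powr \<beta>" by auto
    then show ?thesis unfolding growth_conclusion_def using 1
      by (intro exI[of _ M] conjI exI[of _ r0]) (auto intro: order_trans[OF _ abs_ge_self])
  next
    case 2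
    have "V (2 * R) - V R \<ge> C" if "R \<ge> a" for R using inc[OF that] 2 a that by simp
    from growth_logarithmic[of a V C, OF mono C a this] obtain M r0
      where "M > 0" "r0 \<ge> 1" "\<forall>r\<ge>r0. V r \<ge> M * ln r" by auto
    then show ?thesis unfolding growth_conclusion_def using 2
      by (intro exI[of _ M] conjI exI[of _ r0]) (auto intro: order_trans[OF _ abs_ge_self])
  next
    case 3
    \<comment> \<open>One increment suffices again: a finite limit l dominates V (2r), so l - V r
      \<ge> V (2r) - V r. If l = \<infinity> the left side of the bound is below \<infinity>, and l
      = -\<infinity> is excluded by V (2r) \<le> l.\<close>
    have "ereal (C * r powr \<beta>) \<le> \<bar>ereal (V r) - ?l\<bar>" if r: "r \<ge> a" for r
    proof -
      have le: "ereal (V (2 * r)) \<le> ?l" using r a by (intro SUP_upper) auto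
      show ?thesis
      proof (cases ?l)
        case (real x)
        then have "V (2 * r) \<le> x" using le by simp
        then show ?thesis using inc[OF r] by (simp add: real)
      qed (use le in auto)
    qed
    then show ?thesis unfolding growth_conclusion_def using 3 C a
      by (intro exI[of _ C] conjI exI[of _ a]) auto
  qed
qed

lemma growth_conclusion_uminus:
  assumes "growth_conclusion \<beta> l V"
  shows "growth_conclusion \<beta> (- l) (\<lambda>r. - V r)"
proof -
  have "\<bar>ereal (- x) - - l\<bar> = \<bar>ereal x - l\<bar>" for x by (cases l) auto
  then show ?thesis using assms by (simp add: growth_conclusion_def)
qed

text \<open>The sign of \<beta> compares sqrt(N-1) with N/2 - 2, and the difference of the squares
  factors as (N-2)(N-10)/4; this is where the threshold 10 comes from.\<close>

lemma exponent_sign: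
  fixes N :: nat
  defines "\<beta> \<equiv> - real N / 2 + sqrt (real N - 1) + 2"
  shows "2 \<le> N \<Longrightarrow> N \<le> 9 \<Longrightarrow> \<beta> > 0" "N = 10 \<Longrightarrow> \<beta> = 0" "N \<ge> 11 \<Longrightarrow> \<beta> < 0"
proof -
  have factor: "(real N / 2 - 2)\<^sup>2 - (real N - 1) = (real N - 2) * (real N - 10) / 4"
    by (simp add: power2_eq_square field_simps)
  show "\<beta> > 0" if N: "2 \<le> N" "N \<le> 9"
  \<comment> \<open>For N = 2 the squares are equal, but N/2 - 2 = -1 is negative and \<beta> =
    2.\<close>
  proof (cases "N = 2")
    case False
    then have "(real N - 2) * (real N - 10) < 0" using N by (intro mult_pos_neg) auto
    then have "real N / 2 - 2 < sqrt (real N - 1)" using factor by (intro real_less_rsqrt) linarith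
    then show ?thesis by (simp add: \<beta>_def)
  qed (simp add: \<beta>_def)
  show "\<beta> = 0" if "N = 10" using that real_sqrt_unique[of 3 9] by (simp add: \<beta>_def)
  show "\<beta> < 0" if N: "N \<ge> 11"
  proof -
    have "(real N - 2) * (real N - 10) > 0" using N by (intro mult_pos_pos) auto
    then have "sqrt (real N - 1) < real N / 2 - 2" using factor N by (intro real_less_lsqrt) linarith+
    then show ?thesis by (simp add: \<beta>_def)
  qed
qed

section \<open>Combination of the estimates after normalising the sign of the radial
  derivative\<close>

theorem proposition2p5:
  fixes N :: nat and f :: "real \<Rightarrow> real" and u :: "real ^ 'n \<Rightarrow> real" and U :: "real \<Rightarrow> real"
  assumes "N = CARD('n)" and "N \<ge> 2"
    and "f C1_differentiable_on UNIV"
    and "classical_solution (- ball 0 1) f u"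
    and "stable_on (- cball 0 1) f u"
    and "\<not> u constant_on (- ball 0 1)"
    and radial: "\<forall>x \<in> - ball 0 1. u x = U (norm x)"
    and "H_L N U"
  shows "\<exists>u_inf :: ereal. ((\<lambda>r. ereal (U r)) \<longlongrightarrow> u_inf) at_top \<and>
    (\<exists>M>0. \<exists>r0\<ge>1.
      (2 \<le> N \<and> N \<le> 9 \<longrightarrow>
        (\<forall>r\<ge>r0. \<bar>U r\<bar> \<ge> M * r powr (- real N / 2 + sqrt (real N - 1) + 2))) \<and>
      (N = 10 \<longrightarrow> (\<forall>r\<ge>r0. \<bar>U r\<bar> \<ge> M * ln r)) \<and>
      (N \<ge> 11 \<longrightarrow>
        (\<forall>r\<ge>r0. \<bar>ereal (U r) - u_inf\<bar> \<ge>
           ereal (M * r powr (- real N / 2 + sqrt (real N - 1) + 2)))))"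
proof -
  have "C2_on (- ball 0 1) u"
    and sol: "\<And>x. x \<in> - ball 0 1 \<Longrightarrow> - laplacian_on (- ball 0 1) u x = f (u x)"
    using assms(4) by (auto simp: classical_solution_def)
  from radial_reduction[OF this(1) radial] obtain w w' where
    cU: "continuous_on {1..} U" and cw: "continuous_on {1..} w"
    and dU: "\<And>r. r > 1 \<Longrightarrow> (U has_real_derivative w r) (at r)"
    and dw: "\<And>r. r > 1 \<Longrightarrow> (w has_real_derivative w' r) (at r)"
    and lap: "\<And>r. r > 1 \<Longrightarrow> \<exists>x. norm x = r \<and>
      laplacian_on (- ball 0 1) u x = w' r + (real DIM(real ^ 'n) - 1) / r * w r"
    by blast
  have ode: "- (w' r + (real N - 1) / r * w r) = f (U r)" if r: "r > 1" for r
  proof -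
    obtain x where x: "norm x = r"
      "laplacian_on (- ball 0 1) u x = w' r + (real DIM(real ^ 'n) - 1) / r * w r"
      using lap[OF r] by blast
    then have "x \<in> - ball 0 1" using r by simp
    then show ?thesis using sol[of x] radial x assms(1) by simp
  qed
  have deriv_U: "deriv U r = w r" if "r > 1" for r using dU[OF that] by (rule DERIV_imp_deriv)
  obtain R1 where R1: "R1 \<ge> 1" and HL: "\<And>R2 \<eta>. R2 > R1 \<Longrightarrow> (\<exists>C. C-lipschitz_on {R1..R2} \<eta>) \<Longrightarrow> \<eta> R2 = 0 \<Longrightarrow>
      (LINT r:{R1..R2}|lebesgue.
        r ^ (N - 1) * (deriv U r)\<^sup>2 * ((deriv \<eta> r)\<^sup>2 - (real N - 1) / r\<^sup>2 * (\<eta> r)\<^sup>2)) \<ge> 0"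
    using assms(8) unfolding H_L_def by blast
  have nz: "w r \<noteq> 0" if r: "r > R1" for r
  proof
    assume w0: "w r = 0"
    have r1: "r > 1" using r R1 by simp
    have cwr: "continuous_on {R1..r} w" by (rule continuous_on_subset[OF cw]) (use R1 in auto)
    have van: "w s = 0" if "s \<in> {R1..r}" for s
      by (rule H_L_zero_imp_vanish[OF HL[OF r] assms(2) R1 r cwr deriv_U dw[OF r1] w0 that])
    \<comment> \<open>An interior point: \<open>w\<close> vanishes around it, so w' m = 0 and the
      equation gives f (U m) = 0, the equilibrium data needed for uniqueness. It exceeds 1 even if
      R1 = 1.\<close>
    define m where "m = (R1 + r) / 2"
    have m: "m \<in> {R1<..<r}" "m > 1" using r R1 by (auto simp: m_def)
    have "(w has_real_derivative 0) (at m)"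
      by (rule has_field_derivative_transform_within_open[OF DERIV_const[of 0] open_greaterThanLessThan m(1)])
        (simp add: van)
    then have "w' m = 0" using dw[OF m(2)] DERIV_unique by blast
    then have fm: "f (U m) = 0" using ode[OF m(2)] van[of m] m by simp
    have const: "U s = U m" if "s > 1" for s
      by (rule radial_ode_stationary[OF assms(3) _ dU dw ode m(2) _ fm that])
        (use assms(2) van m in auto)
    \<comment> \<open>The equation was used for s > 1 only; continuity of \<open>U\<close> adds the
      unit sphere.\<close>
    have "U s = U m" if "s \<ge> 1" for s
      by (rule continuous_constant_on_closure[of "{1<..}" U "U m" s])
        (use cU const that in auto)
    then have "u constant_on (- ball 0 1)"
      using radial by (auto simp: constant_on_def)
    with assms(6) show False ..
  qed
  \<comment> \<open>Beyond R1 the sign of \<open>w\<close> is constant, so \<open>v\<close> below is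
    |w| there and \<open>V\<close> is increasing; the sign is undone at the end by reflecting the
    limit.\<close>
  define s where "s = sgn (w (R1 + 1))"
  have s: "s = 1 \<or> s = -1" using nz[of "R1 + 1"] by (auto simp: s_def sgn_if)
  define v where "v r = s * w r" for r
  have cv: "continuous_on S v" if "S \<subseteq> {1..}" for S
    unfolding v_def by (intro continuous_intros continuous_on_subset[OF cw that])
  have v0: "v r > 0" if r: "r > R1" for r
  proof (rule ccontr)
    have conn: "connected (v ` {R1<..})"
      using R1 by (intro connected_continuous_image cv) auto
    assume "\<not> v r > 0"
    moreover have "v (R1 + 1) > 0" using nz[of "R1 + 1"] by (auto simp: v_def s_def sgn_if)
    ultimately have "v r \<le> 0" "0 \<le> v (R1 + 1)" by simp_all
    then have "0 \<in> v ` {R1<..}"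
      by (rule connectedD_interval[OF conn imageI imageI, of r "R1 + 1", rotated 2])
        (use r in simp_all)
    then show False using nz s by (auto simp: v_def)
  qed
  have v_sq: "(v r)\<^sup>2 = (w r)\<^sup>2" for r using s by (auto simp: v_def)
  let ?a = "sqrt (real N - 1)" and ?\<beta> = "- real N / 2 + sqrt (real N - 1) + 2"
  define V where "V r = s * U r" for r
  have dV: "(V has_real_derivative v r) (at r)" if "r > 1" for r
    unfolding V_def v_def by (intro DERIV_cmult dU that)
  have mono: "V x \<le> V y" if "R1 + 1 \<le> x" "x \<le> y" for x y
  proof (rule DERIV_nonneg_imp_nondecreasing[OF that(2)])
    fix t assume "x \<le> t" "t \<le> y"
    then show "\<exists>d. (V has_real_derivative d) (at t) \<and> 0 \<le> d"
      using dV[of t] v0[of t] R1 that by (intro exI[of _ "v t"]) auto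
  qed
  obtain K where K: "K > 0" and energy: "\<And>R h h'. R \<ge> R1 + 1 \<Longrightarrow>
      (\<And>r. r \<in> {R..2 * R} \<Longrightarrow> (h has_real_derivative h' r) (at r within {R..2 * R})) \<Longrightarrow>
      continuous_on {R..2 * R} h' \<Longrightarrow> h R = R powr (- ?a) \<Longrightarrow> h (2 * R) = 0 \<Longrightarrow>
      K \<le> integral {R..2 * R} (\<lambda>r. r ^ (N - 1) * (w r)\<^sup>2 * (h' r)\<^sup>2)"
    using H_L_energy_bound[OF HL assms(2) R1 cw deriv_U nz] by blast
  define C where "C = sqrt (K / 2 ^ (N - 1))"
  have inc: "V (2 * R) - V R \<ge> C * R powr ?\<beta>" if R: "R \<ge> R1 + 1" for R
  proof -
    have "integral {R..2 * R} v \<ge> C * R powr ((3 - real (N - 1)) / 2 + ?a)"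
      unfolding C_def
    proof (rule energy_imp_increment)
      show "1 \<le> R" using R R1 by simp
      show "continuous_on {R..2 * R} v" by (rule cv) (use R R1 in auto)
      show "v r > 0" if "r \<in> {R..2 * R}" for r using that R by (intro v0) auto
      show "K \<le> integral {R..2 * R} (\<lambda>r. r ^ (N - 1) * (v r)\<^sup>2 * (h' r)\<^sup>2)"
        if "\<And>r. r \<in> {R..2 * R} \<Longrightarrow> (h has_real_derivative h' r) (at r within {R..2 * R})"
          "continuous_on {R..2 * R} h'" "h R = R powr (- ?a)" "h (2 * R) = 0" for h h'
        unfolding v_sq by (rule energy[OF R that])
    qed (rule K)
    moreover have "(v has_integral V (2 * R) - V R) {R..2 * R}"
      using R R1 dV by (intro fundamental_theorem_of_calculus)
        (auto simp: has_real_derivative_iff_has_vector_derivative[symmetric]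
          intro: has_field_derivative_at_within)
    moreover have "(3 - real (N - 1)) / 2 + ?a = ?\<beta>"
      using assms(2) by (simp add: of_nat_diff field_simps)
    ultimately show ?thesis by (metis integral_unique)
  qed
  have "C > 0" "R1 + 1 \<ge> 1" using K R1 by (auto simp: C_def)
  from growth_of_increments[OF mono this inc] obtain l
    where l: "((\<lambda>r. ereal (V r)) \<longlongrightarrow> l) at_top" "growth_conclusion ?\<beta> l V" by blast
  have "\<exists>l. ((\<lambda>r. ereal (U r)) \<longlongrightarrow> l) at_top \<and> growth_conclusion ?\<beta> l U"
    using s
  proof
    assume "s = 1"
    then have "U = V" by (simp add: V_def fun_eq_iff)
    then show ?thesis using l by blast
  next
    assume "s = -1"
    then have U: "U = (\<lambda>r. - V r)" by (simp add: V_def fun_eq_iff)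
    have "((\<lambda>r. ereal (- V r)) \<longlongrightarrow> - l) at_top" using tendsto_uminus_ereal[OF l(1)] by simp
    with growth_conclusion_uminus[OF l(2)] show ?thesis unfolding U by blast
  qed
  then obtain l where l: "((\<lambda>r. ereal (U r)) \<longlongrightarrow> l) at_top" and "growth_conclusion ?\<beta> l U" by blast
  then obtain M r0 where "M > 0" "r0 \<ge> 1"
    "?\<beta> > 0 \<Longrightarrow> \<forall>r\<ge>r0. \<bar>U r\<bar> \<ge> M * r powr ?\<beta>"
    "?\<beta> = 0 \<Longrightarrow> \<forall>r\<ge>r0. \<bar>U r\<bar> \<ge> M * ln r"
    "?\<beta> < 0 \<Longrightarrow> \<forall>r\<ge>r0. \<bar>ereal (U r) - l\<bar> \<ge> ereal (M * r powr ?\<beta>)"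
    unfolding growth_conclusion_def by blast
  then show ?thesis
    using exponent_sign[of N] l
    by (intro exI[of _ l] conjI exI[of _ M] exI[of _ r0] impI) blast+
qed

end
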